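(* For any constant deletion probability $p<1$, $O(\log n/(1-p)^k)$ traces from the tensor deletion channel suffice to reconstruct, with high probability, a random $k$-th order tensor $X\in\{0,1\}^{n^{1/k}\times\cdots\times n^{1/k}}$ whose entries are independent and uniform on $\{0,1\}$.
   Context: The tensor deletion channel with deletion probability $p$ takes a $k$-th order tensor with $n^{1/k}$ indices along each dimension and, independently for each dimension and each index along it, deletes the corresponding slice with probability $p$; the output (a trace) is the subtensor formed by the surviving indices in their original relative order, without revealing which were deleted. "With high probability" means with probability at least $1-o(1)$ as $n\to\infty$, over the randomness of $X$ and the channel.
   Formalization: The order is assumed to be k ≥ 2: for k = 1 the claim concerns random strings, where for constant 0 < p < 1 superlogarithmically many traces are known to be necessary, so it fails. *)

theory Defs
  imports "HOL-Probability.Product_PMF" "HOL-Library.Monad_Syntax"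
begin

text \<open>
  A 0/1 tensor of order \<open>k\<close> is given by the list of its \<open>k\<close> side lengths together with its
  entries (\<open>True\<close> stands for 1). Entries outside the index range are kept at the default
  \<open>False\<close> by the operations below, so that equality on this type is equality of tensors.
\<close>

datatype tensor = Tensor (shape: "nat list") (entry: "nat list \<Rightarrow> bool")

definition tensor_idx :: "nat list \<Rightarrow> nat list set" where
  "tensor_idx ds = {is. list_all2 (<) is ds}"

definition uniform_tensor :: "nat list \<Rightarrow> tensor pmf" where
  "uniform_tensor ds =
     map_pmf (Tensor ds) (Pi_pmf (tensor_idx ds) False (\<lambda>_. bernoulli_pmf (1/2)))"

text \<open>
  \<open>subtensor S X\<close> keeps, along each dimension \<open>j\<close>, the slices whose indices are listed in
  \<open>S ! j\<close>, renumbered from 0 in the order of that list.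
\<close>

definition subtensor :: "nat list list \<Rightarrow> tensor \<Rightarrow> tensor" where
  "subtensor S X =
     Tensor (map length S)
       (\<lambda>is. is \<in> tensor_idx (map length S) \<and> entry X (map2 (!) S is))"

text \<open>The pair \<open>(j, i)\<close> denotes the slice with index \<open>i\<close> along dimension \<open>j\<close>.\<close>

definition slices :: "nat list \<Rightarrow> (nat \<times> nat) set" where
  "slices ds = (SIGMA j:{..<length ds}. {..<ds ! j})"

definition surviving :: "(nat \<times> nat \<Rightarrow> bool) \<Rightarrow> nat list \<Rightarrow> nat list list" where
  "surviving del ds =
     map (\<lambda>j. filter (\<lambda>i. \<not> del (j, i)) [0..<ds ! j]) [0..<length ds]"

definition deletion_channel :: "real \<Rightarrow> tensor \<Rightarrow> tensor pmf" where
  "deletion_channel p X =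
     map_pmf (\<lambda>del. subtensor (surviving del (shape X)) X)
       (Pi_pmf (slices (shape X)) False (\<lambda>_. bernoulli_pmf p))"

text \<open>
  Joint distribution of a uniformly random tensor of shape \<open>ds\<close> and \<open>T\<close> traces of it, which
  are independent given the tensor.
\<close>

definition tensor_with_traces :: "real \<Rightarrow> nat \<Rightarrow> nat list \<Rightarrow> (tensor \<times> tensor list) pmf" where
  "tensor_with_traces p T ds = do {
     X \<leftarrow> uniform_tensor ds;
     ys \<leftarrow> replicate_pmf T (deletion_channel p X);
     return_pmf (X, ys)
   }"

end

theory Submission
  imports Defs "HOL-Real_Asymp.Real_Asymp"
begin

text \<open>
  The decoder looks for any explanation of the traces by a tensor and \<open>T\<close> deletion patterns that
  satisfies three typical properties, and outputs the tensor of that explanation. First, any \<open>k\<close>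
  slices survive together in some trace. Second, any two traces share many slices along every
  dimension. Third, the tensor is rigid with respect to any two traces: the true matching \<open>M\<close>
  between the slices of the two traces is the only matching that is at least as large as \<open>M\<close>
  and compatible with all common entries.

  Two explanations of the same traces have the same matchings, because each of the two matchings
  competes with the other and the smaller one belongs to a rigid tensor. Hence the renumberings of
  slices glue together to strictly increasing maps from \<open>{..<m}\<close> to itself, which are identities,
  so the two tensors agree.

  The coverage property needs \<open>O(log n / (1 - p)^k)\<close> traces. For rigidity, a competing matching \<open>N\<close>
  that has \<open>d\<close> pairs outside of \<open>M\<close> forces on the order of \<open>d s\<close> independent equations between
  random bits, where \<open>s\<close> is the overlap along each dimension. There are at most \<open>(k m^2 + 1)^(2 d)\<close>
  such matchings, so a union bound suffices as soon as \<open>s\<close> is large compared to \<open>log m\<close>; we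
  take \<open>s = sqrt m\<close>.
\<close>

subsection \<open>Rigidity of random tensors\<close>

lemma uniform_bits_eq:
  assumes "finite I"
  shows "Pi_pmf I False (\<lambda>_. bernoulli_pmf (1/2)) = pmf_of_set (PiE_dflt I False (\<lambda>_. UNIV))"
  using assms by (simp add: bernoulli_pmf_half_conv_pmf_of_set Pi_pmf_of_set)

text \<open>Each equation at least halves the number of solutions. Add the equations by increasing
  rank: the newest \<open>x\<close> is neither in \<open>S\<close> nor of the form
  \<open>g y\<close> with \<open>y\<close> in \<open>S\<close>, since
  \<open>r (g y) < r y \<le> r x\<close>. Flipping the bit at \<open>x\<close> thus keeps the old
  equations and breaks the new one, so the solutions and their flips are disjoint.\<close>

lemma card_acyclic_equations:
  fixes r :: "'a \<Rightarrow> int"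
  assumes "finite I" "finite Z" "Z \<subseteq> I" "\<And>x. x \<in> Z \<Longrightarrow> r (g x) < r x"
  shows "2 ^ card Z * card {f \<in> PiE_dflt I False (\<lambda>_. UNIV). \<forall>x\<in>Z. f x = f (g x)}
           \<le> card (PiE_dflt I False (\<lambda>_. UNIV :: bool set))"
  using assms(2-)
proof (induction Z rule: finite_ranking_induct[where f = r])
  case empty
  then show ?case by simp
next
  case (insert x S)
  let ?\<Omega> = "PiE_dflt I False (\<lambda>_. UNIV :: bool set)"
  let ?sol = "\<lambda>Z. {f \<in> ?\<Omega>. \<forall>x\<in>Z. f x = f (g x)}"
  show ?case
  proof (cases "x \<in> S")
    case True
    then show ?thesis using insert by (simp add: insert_absorb)
  next
    case False
    have fin: "finite ?\<Omega>" using assms(1) by auto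
    define flip where "flip f = f(x := \<not> f x)" for f :: "'a \<Rightarrow> bool"
    have rx: "r (g x) < r x" using insert.prems by simp
    have gx: "g x \<noteq> x" using rx by auto
    have gS: "g y \<noteq> x" if "y \<in> S" for y
      using insert.hyps(2)[OF that] insert.prems(2)[of y] that by auto
    have inj: "inj_on flip A" for A
      by (rule inj_on_inverseI[where g = flip]) (simp add: flip_def fun_eq_iff)
    have sub: "?sol (insert x S) \<subseteq> ?sol S" "flip ` ?sol (insert x S) \<subseteq> ?sol S"
      using False gS insert.prems(1) by (auto simp: flip_def PiE_dflt_def split: if_splits)
    have disj: "?sol (insert x S) \<inter> flip ` ?sol (insert x S) = {}"
      using gx by (auto simp: flip_def)
    have "2 * card (?sol (insert x S)) = card (?sol (insert x S) \<union> flip ` ?sol (insert x S))"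
      using disj fin by (subst card_Un_disjoint) (auto simp: card_image[OF inj])
    also have "\<dots> \<le> card (?sol S)"
      using sub fin by (intro card_mono) auto
    finally have *: "2 * card (?sol (insert x S)) \<le> card (?sol S)" .
    have "2 ^ card (insert x S) * card (?sol (insert x S))
            = 2 ^ card S * (2 * card (?sol (insert x S)))"
      using False insert.hyps(1) by simp
    also have "\<dots> \<le> 2 ^ card S * card (?sol S)"
      using * by (rule mult_left_mono) simp
    also have "\<dots> \<le> card ?\<Omega>"
      using insert by simp
    finally show ?thesis .
  qed
qed

lemma prob_acyclic_equations:
  fixes r :: "'a \<Rightarrow> int"
  assumes "finite I" "Z \<subseteq> I" "\<And>x. x \<in> Z \<Longrightarrow> r (g x) < r x"
  shows "measure_pmf.prob (Pi_pmf I False (\<lambda>_. bernoulli_pmf (1/2))) {f. \<forall>x\<in>Z. f x = f (g x)}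
           \<le> (1/2) ^ card Z"
proof -
  let ?\<Omega> = "PiE_dflt I False (\<lambda>_. UNIV :: bool set)"
  have fin: "finite ?\<Omega>" "?\<Omega> \<noteq> {}" using assms(1) by auto
  then have pos: "0 < card ?\<Omega>" by (simp add: card_gt_0_iff)
  have "real (2 ^ card Z * card {f \<in> ?\<Omega>. \<forall>x\<in>Z. f x = f (g x)}) \<le> real (card ?\<Omega>)"
    using assms finite_subset[OF assms(2,1)]
    by (intro of_nat_mono card_acyclic_equations[where r = r])
  then have "real (card {f \<in> ?\<Omega>. \<forall>x\<in>Z. f x = f (g x)}) / card ?\<Omega> \<le> (1/2) ^ card Z"
    using pos by (simp add: field_simps)
  moreover have "?\<Omega> \<inter> {f. \<forall>x\<in>Z. f x = f (g x)} = {f \<in> ?\<Omega>. \<forall>x\<in>Z. f x = f (g x)}"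
    by auto
  ultimately show ?thesis
    using fin assms(1) by (simp add: uniform_bits_eq measure_pmf_of_set)
qed

section \<open>Matchings between the slices of two traces, and their rivals\<close>

text \<open>
  A matching is a set of triples \<open>(j, x, y)\<close>: the slice \<open>x\<close> along dimension \<open>j\<close>, seen in the first
  trace, is identified with the slice \<open>y\<close>, seen in the second one. The true matching \<open>M\<close> is diagonal.
\<close>

definition consistent :: "nat \<Rightarrow> (nat \<times> nat \<times> nat) set \<Rightarrow> (nat list \<Rightarrow> bool) \<Rightarrow> bool" where
  "consistent k N f \<longleftrightarrow> (\<forall>x y. length x = k \<longrightarrow> length y = k \<longrightarrow>
      (\<forall>j<k. (j, x ! j, y ! j) \<in> N) \<longrightarrow> f x = f y)"

text \<open>These are the properties of the matching that another explanation of the same two traces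
  induces. A diagonal pair is a slice that survived in both traces, hence lies in \<open>M\<close>.
  The comparison of cardinalities ensures that a rival has at least as many pairs outside
  \<open>M\<close> as it misses from \<open>M\<close>.\<close>

definition rival ::
  "real \<Rightarrow> nat \<Rightarrow> nat \<Rightarrow> (nat \<times> nat \<times> nat) set \<Rightarrow> (nat \<times> nat \<times> nat) set \<Rightarrow> bool" where
  "rival s k m M N \<longleftrightarrow> N \<subseteq> {..<k} \<times> {..<m} \<times> {..<m} \<and>
     (\<forall>j x y y'. (j, x, y) \<in> N \<longrightarrow> (j, x, y') \<in> N \<longrightarrow> y = y') \<and>
     (\<forall>j<k. s \<le> card (N `` {j})) \<and>
     (\<forall>j x. (j, x, x) \<in> N \<longrightarrow> (j, x, x) \<in> M) \<and> card M \<le> card N"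

definition rigid ::
  "real \<Rightarrow> nat \<Rightarrow> nat \<Rightarrow> (nat \<times> nat \<times> nat) set \<Rightarrow> (nat list \<Rightarrow> bool) \<Rightarrow> bool" where
  "rigid s k m M f \<longleftrightarrow> (\<forall>N. rival s k m M N \<longrightarrow> consistent k N f \<longrightarrow> N = M)"

lemma tensor_idx_replicate:
  "tensor_idx (replicate k m) = {x. length x = k \<and> (\<forall>j<k. x ! j < m)}"
  by (auto simp: tensor_idx_def list_all2_conv_all_nth)

lemma tensor_idx_replicate_lists:
  "tensor_idx (replicate k m) = {x. set x \<subseteq> {..<m} \<and> length x = k}"
  unfolding tensor_idx_replicate by (auto simp: set_conv_nth)

lemma finite_tensor_idx: "finite (tensor_idx (replicate k m))"
  unfolding tensor_idx_replicate_lists by (rule finite_lists_length_eq) simp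

lemma card_eq_sum_slices:
  assumes "A \<subseteq> {..<k} \<times> {..<m} \<times> {..<m}"
  shows "card A = (\<Sum>j<k. card ((A :: (nat \<times> nat \<times> nat) set) `` {j}))"
proof -
  have "A = (SIGMA j:{..<k}. A `` {j})" using assms by auto
  moreover have "finite (A `` {j})" for j
    by (rule finite_subset[of _ "{..<m} \<times> {..<m}"]) (use assms in auto)
  ultimately show ?thesis by (metis card_SigmaI finite_lessThan)
qed

lemma card_pairs_functional:
  assumes "A \<subseteq> B" "\<And>x y y'. (x, y) \<in> B \<Longrightarrow> (x, y') \<in> B \<Longrightarrow> y = y'"
  shows "card (fst ` A) = card A"
  by (rule card_image) (use assms in \<open>fastforce simp: inj_on_def\<close>)

text \<open>
  A pair of the matching that moves an index along dimension \<open>j\<close> forces as many equations between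
  entries of the tensor as there are matched indices along another dimension. Pairs moving the
  index in the same direction give acyclic equations.
\<close>

lemma prob_consistent_le:
  assumes "k \<ge> 2" "s \<ge> 1" and N: "rival s k m M N" and M: "M \<subseteq> {..<k} \<times> {..<m} \<times> {..<m}"
  shows "measure_pmf.prob (Pi_pmf (tensor_idx (replicate k m)) False (\<lambda>_. bernoulli_pmf (1/2)))
           {f. consistent k N f} \<le> (2 powr (- s / (4 * k))) ^ card ((N - M) \<union> (M - N))"
proof -
  let ?P = "measure_pmf.prob (Pi_pmf (tensor_idx (replicate k m)) False (\<lambda>_. bernoulli_pmf (1/2)))"
  have Nsub: "N \<subseteq> {..<k} \<times> {..<m} \<times> {..<m}"
    and Nfun: "\<And>j x y y'. (j, x, y) \<in> N \<Longrightarrow> (j, x, y') \<in> N \<Longrightarrow> y = y'"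
    and Nbig: "\<And>j. j < k \<Longrightarrow> s \<le> card (N `` {j})"
    and Ndiag: "\<And>j x. (j, x, x) \<in> N \<Longrightarrow> (j, x, x) \<in> M" and NM: "card M \<le> card N"
    using N by (auto simp: rival_def)
  have finNM: "finite N" "finite M"
    using Nsub M by (auto intro: finite_subset)
  have finNj: "finite (N `` {j})" for j
    by (rule finite_subset[of _ "{..<m} \<times> {..<m}"]) (use Nsub in auto)
  define d where "d = card (N - M)"
  \<comment> \<open>As \<open>card M \<le> card N\<close>, the set \<open>M - N\<close> is no larger
    than \<open>N - M\<close>; this costs the first factor 2.\<close>
  have dsym: "card ((N - M) \<union> (M - N)) \<le> 2 * d"
  proof -
    have "card (M - N) \<le> card (N - M)"
      using NM finNM by (metis card_le_sym_Diff)
    then show ?thesis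
      using card_Un_le[of "N - M" "M - N"] by (simp add: d_def)
  qed
  \<comment> \<open>Pigeonhole over the dimensions: some \<open>j\<close> carries at least a
    fraction 1/k of the \<open>d\<close> new pairs.\<close>
  obtain j where j: "j < k" "d \<le> k * card ((N - M) `` {j})"
  proof (rule ccontr)
    assume "\<not> thesis"
    then have *: "k * card ((N - M) `` {j}) < d" if "j < k" for j
      using that \<open>\<And>j. \<lbrakk>j < k; d \<le> k * card ((N - M) `` {j})\<rbrakk> \<Longrightarrow> thesis\<close> by force
    have "k * d = (\<Sum>j<k. k * card ((N - M) `` {j}))"
      using Nsub by (subst d_def, subst card_eq_sum_slices[of _ k m]) (auto simp: sum_distrib_left)
    also have "\<dots> < (\<Sum>j<k. d)"
      using * assms(1) by (intro sum_strict_mono) (auto simp: lessThan_empty_iff)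
    finally show False by simp
  qed
  \<comment> \<open>New pairs are off the diagonal by \<open>Ndiag\<close>, so each moves its index
    up or down. The larger class becomes \<open>C\<close>, and the sign \<open>\<sigma>\<close>
    makes the \<open>j\<close>-th coordinate decrease along \<open>C\<close> in either case.\<close>
  define U where "U = {p \<in> N `` {j}. fst p < snd p}"
  define D where "D = {p \<in> N `` {j}. snd p < fst p}"
  have "(N - M) `` {j} \<subseteq> U \<union> D"
    using Ndiag by (auto simp: U_def D_def) (metis nat_neq_iff)
  then have "card ((N - M) `` {j}) \<le> card U + card D"
    using finNj[of j] by (metis (no_types, lifting) D_def U_def card_Un_le card_mono finite_Un
        finite_Collect_conjI finite_subset le_trans mem_Collect_eq subsetI)
  then obtain C \<sigma> where C: "card ((N - M) `` {j}) \<le> 2 * card C" "C \<subseteq> N `` {j}"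
    and \<sigma>: "\<And>x y. (x, y) \<in> C \<Longrightarrow> \<sigma> * int y < \<sigma> * int x"
  proof (cases "card U \<le> card D")
    case True
    then show ?thesis
      using that[of D 1] \<open>card ((N - M) `` {j}) \<le> card U + card D\<close> by (auto simp: D_def)
  next
    case False
    then show ?thesis
      using that[of U "-1"] \<open>card ((N - M) `` {j}) \<le> card U + card D\<close> by (auto simp: U_def)
  qed
  \<comment> \<open>A second dimension, available since \<open>k \<ge> 2\<close>; its matched
    indices multiply the number of equations.\<close>
  define l where "l = (if j = 0 then 1 else 0::nat)"
  have l: "l < k" "l \<noteq> j" using assms(1) by (auto simp: l_def)
  define h where "h i x = (SOME y. (i, x, y) \<in> N)" for i x
  have h: "(i, x, h i x) \<in> N" if "(i, x, y) \<in> N" for i x y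
    using that unfolding h_def by (rule someI)
  have "\<exists>x y. (i, x, y) \<in> N" if "i < k" for i
  proof -
    have "N `` {i} \<noteq> {}" using Nbig[OF that] assms(2) by force
    then show ?thesis by auto
  qed
  then obtain w v where w: "\<And>i. i < k \<Longrightarrow> (i, w i, v i) \<in> N" by metis
  \<comment> \<open>Coordinate \<open>j\<close> runs through the sources of \<open>C\<close>,
    coordinate \<open>l\<close> through all matched sources, and the others stay at the matched
    index \<open>w i\<close>. Every such cell has a partner under \<open>N\<close>.\<close>
  define cell where "cell = (\<lambda>(x, y). (map w [0..<k])[j := x, l := y])"
  have cell_nth: "cell p ! i = (if i = l then snd p else if i = j then fst p else w i)"
    if "i < k" for p i
    using that l j(1) by (auto simp: cell_def nth_list_update split: prod.splits)
  have len: "length (cell p) = k" for p by (auto simp: cell_def split: prod.splits)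
  define W where "W = fst ` C \<times> fst ` (N `` {l})"
  have "inj_on cell W"
  proof (rule inj_onI)
    fix p q assume "cell p = cell q"
    then show "p = q"
      using cell_nth[OF j(1), of p] cell_nth[OF j(1), of q] cell_nth[OF l(1), of p]
        cell_nth[OF l(1), of q] l(2) by (auto simp: prod_eq_iff)
  qed
  then have "card (cell ` W) = card (fst ` C) * card (fst ` (N `` {l}))"
    by (simp add: card_image W_def card_cartesian_product)
  also have "card (fst ` C) = card C"
    using C(2) Nfun by (intro card_pairs_functional[of _ "N `` {j}"]) auto
  also have "card (fst ` (N `` {l})) = card (N `` {l})"
    using Nfun by (intro card_pairs_functional[of _ "N `` {l}"]) auto
  finally have cardZ: "card (cell ` W) = card C * card (N `` {l})" .
  have in_N: "(i, z ! i, h i (z ! i)) \<in> N" if "z \<in> cell ` W" "i < k" for i z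
  proof -
    have "\<exists>y. (i, z ! i, y) \<in> N"
      using that w[OF that(2)] C(2) by (auto simp: W_def cell_nth) blast+
    then show ?thesis using h by blast
  qed
  define g where "g z = map (\<lambda>i. h i (z ! i)) [0..<k]" for z
  have "?P {f. consistent k N f} \<le> ?P {f. \<forall>z\<in>cell ` W. f z = f (g z)}"
  proof (intro measure_pmf.finite_measure_mono subsetI CollectI ballI)
    fix f z assume f: "f \<in> {f. consistent k N f}" and z: "z \<in> cell ` W"
    have "\<forall>i<k. (i, z ! i, g z ! i) \<in> N"
      using in_N[OF z] by (simp add: g_def)
    moreover have "length z = k" "length (g z) = k"
      using z len by (auto simp: g_def)
    ultimately show "f z = f (g z)"
      using f unfolding consistent_def by blast
  qed simp
  also have "\<dots> \<le> (1/2) ^ card (cell ` W)"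
  proof (rule prob_acyclic_equations[OF finite_tensor_idx])
    show "cell ` W \<subseteq> tensor_idx (replicate k m)"
      using in_N Nsub len by (fastforce simp: tensor_idx_replicate)
  next
    fix z assume "z \<in> cell ` W"
    then obtain p where p: "p \<in> W" "z = cell p" by auto
    then obtain y where "(fst p, y) \<in> C" by (auto simp: W_def)
    moreover have "h j (fst p) = y"
      using calculation C(2) h Nfun by blast
    ultimately show "\<sigma> * int (g z ! j) < \<sigma> * int (z ! j)"
      using \<sigma> p j(1) l(2) by (simp add: g_def cell_nth)
  qed
  also have "\<dots> = 2 powr (- real (card C * card (N `` {l})))"
    by (simp add: cardZ powr_minus powr_realpow power_one_over inverse_eq_divide del: of_nat_mult)
  also have "\<dots> \<le> 2 powr ((- s / (4 * k)) * card ((N - M) \<union> (M - N)))"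
  proof -
    \<comment> \<open>The factor 4 k collects 2 for the symmetric difference, k for the choice of
      the dimension and 2 for the direction.\<close>
    have "real (card ((N - M) \<union> (M - N))) \<le> real (4 * k * card C)"
    proof (rule of_nat_mono)
      have "card ((N - M) \<union> (M - N)) \<le> 2 * (k * (2 * card C))"
        using dsym j(2) C(1) by (meson le_trans mult_le_mono2)
      then show "card ((N - M) \<union> (M - N)) \<le> 4 * k * card C" by simp
    qed
    then have "card ((N - M) \<union> (M - N)) * s \<le> (4 * k * card C) * real (card (N `` {l}))"
      using Nbig[OF l(1)] assms(2) by (intro mult_mono) auto
    then have "(s / (4 * k)) * card ((N - M) \<union> (M - N)) \<le> card C * card (N `` {l})"
      using assms(1) by (simp add: field_simps)
    then show ?thesis by simp
  qed
  also have "\<dots> = (2 powr (- s / (4 * k))) ^ card ((N - M) \<union> (M - N))"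
    by (subst powr_powr[symmetric], subst powr_realpow) auto
  finally show ?thesis .
qed

lemma sum_Pow_power_card:
  fixes u :: real
  assumes "finite A"
  shows "(\<Sum>X\<in>Pow A. u ^ card X) = (1 + u) ^ card A"
  using prod_add[OF assms, of "\<lambda>_. u" "\<lambda>_. 1"] by (simp add: add.commute)

text \<open>Union bound over the rivals \<open>N\<close> other than \<open>M\<close>. Each is
  determined by its symmetric difference with \<open>M\<close>, a nonempty subset of a grid of k m^2
  triples, so the sum is at most the binomial expansion without the term of the empty set.\<close>

lemma prob_not_rigid_le:
  assumes "k \<ge> 2" "s \<ge> 1" and M: "M \<subseteq> {..<k} \<times> {..<m} \<times> {..<m}"
  shows "measure_pmf.prob (Pi_pmf (tensor_idx (replicate k m)) False (\<lambda>_. bernoulli_pmf (1/2)))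
           {f. \<not> rigid s k m M f} \<le> (1 + 2 powr (- s / (4 * k))) ^ (k * m\<^sup>2) - 1"
proof -
  let ?P = "measure_pmf.prob (Pi_pmf (tensor_idx (replicate k m)) False (\<lambda>_. bernoulli_pmf (1/2)))"
  let ?G = "{..<k} \<times> {..<m} \<times> {..<m}"
  define u where "u = 2 powr (- s / (4 * k))"
  define \<N> where "\<N> = {N. rival s k m M N \<and> N \<noteq> M}"
  define \<Delta> where "\<Delta> N = (N - M) \<union> (M - N)" for N
  have sub: "\<N> \<subseteq> Pow ?G" by (auto simp: \<N>_def rival_def)
  have fin: "finite \<N>" by (rule finite_subset[OF sub]) simp
  have "?P {f. \<not> rigid s k m M f} \<le> ?P (\<Union>N\<in>\<N>. {f. consistent k N f})"
    by (rule measure_pmf.finite_measure_mono) (auto simp: rigid_def \<N>_def)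
  also have "\<dots> \<le> (\<Sum>N\<in>\<N>. ?P {f. consistent k N f})"
    by (rule measure_pmf.finite_measure_subadditive_finite[OF fin]) simp
  also have "\<dots> \<le> (\<Sum>N\<in>\<N>. u ^ card (\<Delta> N))"
    unfolding u_def \<Delta>_def using assms
    by (intro sum_mono prob_consistent_le) (auto simp: \<N>_def)
  also have "\<dots> = (\<Sum>X\<in>\<Delta> ` \<N>. u ^ card X)"
  proof -
    have "inj_on \<Delta> \<N>" by (rule inj_onI) (auto simp: \<Delta>_def)
    then show ?thesis by (simp add: sum.reindex)
  qed
  also have "\<dots> \<le> (\<Sum>X\<in>Pow ?G - {{}}. u ^ card X)"
  proof (rule sum_mono2)
    show "\<Delta> ` \<N> \<subseteq> Pow ?G - {{}}"
      using sub M by (auto simp: \<Delta>_def) (auto simp: \<N>_def)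
  qed (auto simp: u_def)
  also have "\<dots> = (1 + u) ^ (k * m\<^sup>2) - 1"
    using sum_Pow_power_card[of ?G u]
    by (subst sum_diff1) (auto simp: card_cartesian_product power2_eq_square)
  finally show ?thesis by (simp add: u_def)
qed

subsection \<open>Explanations of the same traces\<close>

definition kept :: "nat \<Rightarrow> (nat \<times> nat \<Rightarrow> bool) \<Rightarrow> nat \<Rightarrow> nat list" where
  "kept m del j = filter (\<lambda>i. \<not> del (j, i)) [0..<m]"

lemma surviving_replicate: "surviving del (replicate k m) = map (kept m del) [0..<k]"
  by (auto simp: surviving_def kept_def)

lemma set_kept: "set (kept m del j) = {i. i < m \<and> \<not> del (j, i)}"
  by (auto simp: kept_def)

lemma kept_nth:
  assumes "a < length (kept m del j)"
  shows "kept m del j ! a < m" "\<not> del (j, kept m del j ! a)"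
  using nth_mem[OF assms] by (simp_all add: set_kept)

lemma kept_nth_eq_iff:
  "a < length (kept m del j) \<Longrightarrow> b < length (kept m del j) \<Longrightarrow>
   kept m del j ! a = kept m del j ! b \<longleftrightarrow> a = b"
  by (rule nth_eq_iff_index_eq) (simp add: kept_def)

lemma kept_less_iff:
  assumes "a < length (kept m del j)" "b < length (kept m del j)"
  shows "kept m del j ! a < kept m del j ! b \<longleftrightarrow> a < b"
proof -
  have "sorted_wrt (<) (kept m del j)"
    unfolding kept_def by (intro sorted_wrt_filter) simp
  then show ?thesis
    using assms by (metis linorder_neqE_nat order_less_asym sorted_wrt_nth_less order_less_irrefl)
qed

definition trace_of :: "nat \<Rightarrow> nat \<Rightarrow> (nat list \<Rightarrow> bool) \<Rightarrow> (nat \<times> nat \<Rightarrow> bool) \<Rightarrow> tensor" where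
  "trace_of k m f del = subtensor (surviving del (replicate k m)) (Tensor (replicate k m) f)"

lemma trace_eq_length:
  assumes "trace_of k m f del = trace_of k m f' del'" "j < k"
  shows "length (kept m del j) = length (kept m del' j)"
  using assms by (auto simp: trace_of_def subtensor_def surviving_replicate)

text \<open>Both sides are the entry of the common trace at position \<open>a\<close>, read back
  through the two deletion patterns.\<close>

lemma trace_eq_entry:
  assumes eq: "trace_of k m f del = trace_of k m f' del'"
    and a: "\<And>j. j < k \<Longrightarrow> a j < length (kept m del j)"
  shows "f (map (\<lambda>j. kept m del j ! a j) [0..<k]) = f' (map (\<lambda>j. kept m del' j ! a j) [0..<k])"
proof -
  have e: "entry (trace_of k m g d) (map a [0..<k]) \<longleftrightarrow> g (map (\<lambda>j. kept m d j ! a j) [0..<k])"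
    if "\<And>j. j < k \<Longrightarrow> a j < length (kept m d j)" for g d
  proof -
    have "map2 (!) (map (kept m d) [0..<k]) (map a [0..<k]) = map (\<lambda>j. kept m d j ! a j) [0..<k]"
      by (rule nth_equalityI) auto
    then show ?thesis
      using that by (simp add: trace_of_def subtensor_def surviving_replicate tensor_idx_def
          list_all2_conv_all_nth)
  qed
  show ?thesis
    using e[of del f] e[of del' f'] a eq trace_eq_length[OF eq] by simp
qed

text \<open>The index is doubled so that the true matching has the same type as its rivals.\<close>

definition common ::
  "nat \<Rightarrow> nat \<Rightarrow> (nat \<times> nat \<Rightarrow> bool) \<Rightarrow> (nat \<times> nat \<Rightarrow> bool) \<Rightarrow> (nat \<times> nat \<times> nat) set" where
  "common k m d d' = {(j, x, y). x = y \<and> j < k \<and> x < m \<and> \<not> d (j, x) \<and> \<not> d' (j, x)}"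

text \<open>
  The matching of positions induced by the second explanation, read in the coordinates of the
  first one, is a rival of the true matching; by rigidity both coincide.
\<close>

lemma same_slice_iff:
  assumes rig: "rigid s k m (common k m d\<^sub>1 d\<^sub>2) f"
    and eq1: "trace_of k m f d\<^sub>1 = trace_of k m f' d\<^sub>1'" and eq2: "trace_of k m f d\<^sub>2 = trace_of k m f' d\<^sub>2'"
    and big: "\<And>j. j < k \<Longrightarrow> s \<le> card (common k m d\<^sub>1' d\<^sub>2' `` {j})"
    and le: "card (common k m d\<^sub>1 d\<^sub>2) \<le> card (common k m d\<^sub>1' d\<^sub>2')"
    and j: "j < k" and a: "a < length (kept m d\<^sub>1 j)" and b: "b < length (kept m d\<^sub>2 j)"
  shows "kept m d\<^sub>1 j ! a = kept m d\<^sub>2 j ! b \<longleftrightarrow> kept m d\<^sub>1' j ! a = kept m d\<^sub>2' j ! b"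
proof -
  note len = trace_eq_length[OF eq1] trace_eq_length[OF eq2]
  \<comment> \<open>Pairs of positions that the second explanation places on the same slice;
    \<open>N\<close> is this set in the coordinates of the first explanation.\<close>
  define P where "P = {(j, a, b). j < k \<and> a < length (kept m d\<^sub>1 j) \<and> b < length (kept m d\<^sub>2 j)
    \<and> kept m d\<^sub>1' j ! a = kept m d\<^sub>2' j ! b}"
  define coords where "coords u v = (\<lambda>(j, a, b). (j, kept m u j ! a, kept m v j ! b))" for u v
  define N where "N = coords d\<^sub>1 d\<^sub>2 ` P"
  have N_iff: "(j, x, y) \<in> N \<longleftrightarrow> (\<exists>a b. (j, a, b) \<in> P \<and> x = kept m d\<^sub>1 j ! a \<and> y = kept m d\<^sub>2 j ! b)"
    for j x y
    unfolding N_def coords_def by force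
  have PD: "j < k" "a < length (kept m d\<^sub>1 j)" "b < length (kept m d\<^sub>2 j)"
    "a < length (kept m d\<^sub>1' j)" "b < length (kept m d\<^sub>2' j)"
    "kept m d\<^sub>1' j ! a = kept m d\<^sub>2' j ! b" if "(j, a, b) \<in> P" for j a b
    using that len[of j] unfolding P_def by auto
  have PI: "(j, a, b) \<in> P" if "j < k" "a < length (kept m d\<^sub>1 j)" "b < length (kept m d\<^sub>2 j)"
    "kept m d\<^sub>1' j ! a = kept m d\<^sub>2' j ! b" for j a b
    using that by (simp add: P_def)
  \<comment> \<open>In the coordinates of the second explanation, \<open>P\<close> is the true
    matching there. Hence \<open>N\<close> has the same size in every dimension, which transfers
    \<open>big\<close> and \<open>le\<close> to \<open>N\<close>.\<close>
  have common': "common k m d\<^sub>1' d\<^sub>2' = coords d\<^sub>1' d\<^sub>2' ` P"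
  proof (intro equalityI subsetI)
    fix t assume "t \<in> common k m d\<^sub>1' d\<^sub>2'"
    then obtain j x where t: "t = (j, x, x)" "j < k" "x \<in> set (kept m d\<^sub>1' j)"
      "x \<in> set (kept m d\<^sub>2' j)"
      by (auto simp: common_def set_kept)
    obtain a where a: "a < length (kept m d\<^sub>1 j)" "kept m d\<^sub>1' j ! a = x"
      using t(3) len(1)[OF t(2)] by (auto simp: in_set_conv_nth)
    obtain b where b: "b < length (kept m d\<^sub>2 j)" "kept m d\<^sub>2' j ! b = x"
      using t(4) len(2)[OF t(2)] by (auto simp: in_set_conv_nth)
    show "t \<in> coords d\<^sub>1' d\<^sub>2' ` P"
      using t(1) a b PI[OF t(2) a(1) b(1)]
      by (intro image_eqI[of _ _ "(j, a, b)"]) (simp_all add: coords_def)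
  next
    fix t assume "t \<in> coords d\<^sub>1' d\<^sub>2' ` P"
    then obtain j a b where t: "t = (j, kept m d\<^sub>1' j ! a, kept m d\<^sub>2' j ! b)" and p: "(j, a, b) \<in> P"
      by (auto simp: coords_def)
    show "t \<in> common k m d\<^sub>1' d\<^sub>2'"
      using t PD(1,6)[OF p] kept_nth[OF PD(4)[OF p]] kept_nth[OF PD(5)[OF p]]
      by (simp add: common_def)
  qed
  have inj_coords: "inj_on (coords u v) P"
    if "\<And>j a b. (j, a, b) \<in> P \<Longrightarrow> a < length (kept m u j)"
      "\<And>j a b. (j, a, b) \<in> P \<Longrightarrow> b < length (kept m v j)" for u v
  proof (rule inj_onI)
    fix t t' assume tt': "t \<in> P" "t' \<in> P" "coords u v t = coords u v t'"
    obtain j a b j' a' b' where t: "t = (j, a, b)" "t' = (j', a', b')"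
      by (metis prod_cases3)
    then have "j' = j" "kept m u j ! a = kept m u j ! a'" "kept m v j ! b = kept m v j ! b'"
      using tt'(3) by (auto simp: coords_def)
    then show "t = t'"
      using tt'(1,2) that[of j a b] that[of j a' b'] unfolding t by (simp add: kept_nth_eq_iff)
  qed
  have inj: "inj_on (coords d\<^sub>1 d\<^sub>2) P" "inj_on (coords d\<^sub>1' d\<^sub>2') P"
    by (rule inj_coords; erule PD)+
  have slice: "card ((coords u v ` P) `` {j}) = card (P `` {j})" if "inj_on (coords u v) P" for u v j
  proof -
    have "(coords u v ` P) `` {j} = (\<lambda>(a, b). (kept m u j ! a, kept m v j ! b)) ` (P `` {j})"
    proof (intro equalityI subsetI)
      fix q assume "q \<in> (coords u v ` P) `` {j}"
      then obtain a b where "(j, a, b) \<in> P" "q = (kept m u j ! a, kept m v j ! b)"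
        by (auto simp: coords_def)
      then show "q \<in> (\<lambda>(a, b). (kept m u j ! a, kept m v j ! b)) ` (P `` {j})"
        by (intro image_eqI[of _ _ "(a, b)"]) simp_all
    next
      fix q assume "q \<in> (\<lambda>(a, b). (kept m u j ! a, kept m v j ! b)) ` (P `` {j})"
      then obtain a b where "(j, a, b) \<in> P" "q = (kept m u j ! a, kept m v j ! b)"
        by auto
      then have "(j, q) \<in> coords u v ` P"
        by (intro image_eqI[of _ _ "(j, a, b)"]) (simp_all add: coords_def)
      then show "q \<in> (coords u v ` P) `` {j}"
        by simp
    qed
    moreover have "inj_on (\<lambda>(a, b). (kept m u j ! a, kept m v j ! b)) (P `` {j})"
    proof (rule inj_onI)
      fix p q assume "p \<in> P `` {j}" "q \<in> P `` {j}"
        "(\<lambda>(a, b). (kept m u j ! a, kept m v j ! b)) p = (\<lambda>(a, b). (kept m u j ! a, kept m v j ! b)) q"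
      then show "p = q"
        using inj_onD[OF that, of "(j, p)" "(j, q)"] by (simp add: coords_def split: prod.splits)
    qed
    ultimately show ?thesis by (simp add: card_image)
  qed
  have "rival s k m (common k m d\<^sub>1 d\<^sub>2) N"
    unfolding rival_def
  proof (intro conjI allI impI subsetI)
    fix t assume "t \<in> N"
    then obtain j a b where t: "t = (j, kept m d\<^sub>1 j ! a, kept m d\<^sub>2 j ! b)" and p: "(j, a, b) \<in> P"
      by (auto simp: N_def coords_def)
    show "t \<in> {..<k} \<times> {..<m} \<times> {..<m}"
      using t PD(1)[OF p] kept_nth[OF PD(2)[OF p]] kept_nth[OF PD(3)[OF p]] by simp
  next
    fix j x y y' assume "(j, x, y) \<in> N" "(j, x, y') \<in> N"
    then obtain a b a' b' where p: "(j, a, b) \<in> P" "x = kept m d\<^sub>1 j ! a" "y = kept m d\<^sub>2 j ! b"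
      and p': "(j, a', b') \<in> P" "x = kept m d\<^sub>1 j ! a'" "y' = kept m d\<^sub>2 j ! b'"
      unfolding N_iff by blast
    have "a = a'"
      using p(2) p'(2) PD(2)[OF p(1)] PD(2)[OF p'(1)] by (simp add: kept_nth_eq_iff)
    then have "kept m d\<^sub>2' j ! b = kept m d\<^sub>2' j ! b'"
      using PD(6)[OF p(1)] PD(6)[OF p'(1)] by simp
    then have "b = b'"
      using PD(5)[OF p(1)] PD(5)[OF p'(1)] by (simp add: kept_nth_eq_iff)
    then show "y = y'"
      using p(3) p'(3) by simp
  next
    fix j assume "j < k"
    then show "s \<le> card (N `` {j})"
      using big[of j] slice[OF inj(1)] slice[OF inj(2)] unfolding N_def common' by simp
  next
    fix j x assume "(j, x, x) \<in> N"
    then obtain a b where p: "(j, a, b) \<in> P" "x = kept m d\<^sub>1 j ! a" "x = kept m d\<^sub>2 j ! b"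
      unfolding N_iff by blast
    show "(j, x, x) \<in> common k m d\<^sub>1 d\<^sub>2"
      using PD(1)[OF p(1)] kept_nth[OF PD(2)[OF p(1)]] kept_nth[OF PD(3)[OF p(1)]] p(2,3)
      by (simp add: common_def)
  next
    show "card (common k m d\<^sub>1 d\<^sub>2) \<le> card N"
      using le unfolding N_def common' by (simp add: card_image inj)
  qed
  \<comment> \<open>Pass from \<open>f\<close> to \<open>f'\<close> through the first trace, use
    that matched positions are the same slice for \<open>f'\<close>, and return to \<open>f\<close>
    through the second trace.\<close>
  moreover have "consistent k N f"
    unfolding consistent_def
  proof (intro allI impI)
    fix x y :: "nat list"
    assume lxy: "length x = k" "length y = k" and "\<forall>j<k. (j, x ! j, y ! j) \<in> N"
    then have "\<forall>j<k. \<exists>a b. (j, a, b) \<in> P \<and> x ! j = kept m d\<^sub>1 j ! a \<and> y ! j = kept m d\<^sub>2 j ! b"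
      unfolding N_iff by blast
    then obtain \<alpha> \<beta> where P: "\<And>j. j < k \<Longrightarrow> (j, \<alpha> j, \<beta> j) \<in> P"
      and x: "\<And>j. j < k \<Longrightarrow> x ! j = kept m d\<^sub>1 j ! \<alpha> j"
      and y: "\<And>j. j < k \<Longrightarrow> y ! j = kept m d\<^sub>2 j ! \<beta> j"
      by metis
    have "f x = f (map (\<lambda>j. kept m d\<^sub>1 j ! \<alpha> j) [0..<k])"
      using x lxy by (intro arg_cong[of _ _ f] nth_equalityI) auto
    also have "\<dots> = f' (map (\<lambda>j. kept m d\<^sub>1' j ! \<alpha> j) [0..<k])"
      using PD(2)[OF P] by (intro trace_eq_entry[OF eq1])
    also have "map (\<lambda>j. kept m d\<^sub>1' j ! \<alpha> j) [0..<k] = map (\<lambda>j. kept m d\<^sub>2' j ! \<beta> j) [0..<k]"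
      using PD(6)[OF P] by simp
    also have "f' \<dots> = f (map (\<lambda>j. kept m d\<^sub>2 j ! \<beta> j) [0..<k])"
      using PD(3)[OF P] by (intro trace_eq_entry[OF eq2, symmetric])
    also have "\<dots> = f y"
      using y lxy by (intro arg_cong[of _ _ f] nth_equalityI) auto
    finally show "f x = f y" .
  qed
  ultimately have N: "N = common k m d\<^sub>1 d\<^sub>2"
    using rig by (auto simp: rigid_def)
  show ?thesis
  proof
    assume same: "kept m d\<^sub>1 j ! a = kept m d\<^sub>2 j ! b"
    have "(j, kept m d\<^sub>1 j ! a, kept m d\<^sub>2 j ! b) \<in> N"
      using same j kept_nth[OF a] kept_nth[OF b] unfolding N by (simp add: common_def)
    then obtain a' b' where p: "(j, a', b') \<in> P" "kept m d\<^sub>1 j ! a = kept m d\<^sub>1 j ! a'"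
      "kept m d\<^sub>2 j ! b = kept m d\<^sub>2 j ! b'"
      unfolding N_iff by blast
    then have "a = a'" "b = b'"
      using a b PD(2,3)[OF p(1)] by (simp_all add: kept_nth_eq_iff)
    then show "kept m d\<^sub>1' j ! a = kept m d\<^sub>2' j ! b"
      using PD(6)[OF p(1)] by simp
  next
    assume "kept m d\<^sub>1' j ! a = kept m d\<^sub>2' j ! b"
    then have "(j, kept m d\<^sub>1 j ! a, kept m d\<^sub>2 j ! b) \<in> N"
      using PI[OF j a b] unfolding N_iff by blast
    then show "kept m d\<^sub>1 j ! a = kept m d\<^sub>2 j ! b"
      unfolding N by (simp add: common_def)
  qed
qed

section \<open>Gluing the pairwise identifications into the identity\<close>

lemma strict_mono_self_map_eq:
  fixes \<phi> :: "nat \<Rightarrow> nat"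
  assumes mono: "\<And>i i'. i < i' \<Longrightarrow> i' < m \<Longrightarrow> \<phi> i < \<phi> i'" and "\<And>i. i < m \<Longrightarrow> \<phi> i < m" "i < m"
  shows "\<phi> i = i"
proof -
  have lower: "i < m \<Longrightarrow> i \<le> \<phi> i" for i
    by (induction i) (use mono in \<open>force simp: Suc_le_eq intro: le_less_trans\<close>)+
  have "i + n < m \<Longrightarrow> \<phi> i + n \<le> \<phi> (i + n)" for n
    by (induction n) (use mono in \<open>force simp: Suc_le_eq intro: le_less_trans\<close>)+
  from this[of "m - 1 - i"] have "\<phi> i + (m - 1 - i) \<le> \<phi> (m - 1)"
    using assms(3) by simp
  then show ?thesis
    using lower[OF assms(3)] assms(2)[of "m - 1"] assms(3) by simp
qed

text \<open>The lists may repeat slices and may use one dimension several times. This yields both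
  the \<open>k\<close> slices through a cell and any two slices along one dimension.\<close>

definition covering :: "nat \<Rightarrow> nat \<Rightarrow> (nat \<times> nat \<Rightarrow> bool) list \<Rightarrow> bool" where
  "covering k m ds \<longleftrightarrow> (\<forall>ws. set ws \<subseteq> slices (replicate k m) \<longrightarrow> length ws = k \<longrightarrow>
      (\<exists>d\<in>set ds. \<forall>w\<in>set ws. \<not> d w))"

text \<open>\<open>sorted_wrt\<close> ranges over list positions t < t', so a trace is never
  compared with itself.\<close>

definition overlapping :: "real \<Rightarrow> nat \<Rightarrow> nat \<Rightarrow> (nat \<times> nat \<Rightarrow> bool) list \<Rightarrow> bool" where
  "overlapping s k m ds \<longleftrightarrow> sorted_wrt (\<lambda>d d'. \<forall>j<k. s \<le> card (common k m d d' `` {j})) ds"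

definition all_rigid ::
  "real \<Rightarrow> nat \<Rightarrow> nat \<Rightarrow> (nat list \<Rightarrow> bool) \<Rightarrow> (nat \<times> nat \<Rightarrow> bool) list \<Rightarrow> bool" where
  "all_rigid s k m f ds \<longleftrightarrow> sorted_wrt (\<lambda>d d'. rigid s k m (common k m d d') f) ds"

text \<open>The last clause fixes the values of \<open>f\<close> outside the index range, which no
  trace shows.\<close>

definition good ::
  "real \<Rightarrow> nat \<Rightarrow> nat \<Rightarrow> (nat list \<Rightarrow> bool) \<Rightarrow> (nat \<times> nat \<Rightarrow> bool) list \<Rightarrow> bool" where
  "good s k m f ds \<longleftrightarrow> covering k m ds \<and> overlapping s k m ds \<and> all_rigid s k m f ds \<and>
     (\<forall>x. x \<notin> tensor_idx (replicate k m) \<longrightarrow> \<not> f x)"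

lemma slices_replicate: "slices (replicate k m) = {..<k} \<times> {..<m}"
  by (auto simp: slices_def)

text \<open>For two different traces, the explanation with the smaller true matching takes the rigid
  role in \<open>same_slice_iff\<close> and the other one supplies the rival. For t = t' the slices
  listed by \<open>kept\<close> are distinct in both explanations.\<close>

lemma good_same_slice_iff:
  assumes good: "good s k m f ds" "good s k m f' ds'"
    and eq: "map (trace_of k m f) ds = map (trace_of k m f') ds'"
    and t: "t < length ds" "t' < length ds" and j: "j < k"
    and a: "a < length (kept m (ds ! t) j)" and b: "b < length (kept m (ds ! t') j)"
  shows "kept m (ds ! t) j ! a = kept m (ds ! t') j ! b \<longleftrightarrow>
         kept m (ds' ! t) j ! a = kept m (ds' ! t') j ! b"
proof -
  have len: "length ds' = length ds"
    using eq by (metis length_map)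
  have tr: "trace_of k m f (ds ! t) = trace_of k m f' (ds' ! t)" if "t < length ds" for t
    using eq len that by (metis nth_map)
  have *: "kept m (ds ! t) j ! a = kept m (ds ! t') j ! b \<longleftrightarrow>
         kept m (ds' ! t) j ! a = kept m (ds' ! t') j ! b"
    if "t < t'" "t' < length ds" "a < length (kept m (ds ! t) j)" "b < length (kept m (ds ! t') j)"
    for t t' a b
  proof -
    have lt: "t < length ds" using that by simp
    have rig: "rigid s k m (common k m (ds ! t) (ds ! t')) f"
      "rigid s k m (common k m (ds' ! t) (ds' ! t')) f'"
      using good that len by (auto simp: good_def all_rigid_def sorted_wrt_iff_nth_less)
    have big: "\<And>j. j < k \<Longrightarrow> s \<le> card (common k m (ds ! t) (ds ! t') `` {j})"
      "\<And>j. j < k \<Longrightarrow> s \<le> card (common k m (ds' ! t) (ds' ! t') `` {j})"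
      using good that len by (auto simp: good_def overlapping_def sorted_wrt_iff_nth_less)
    note tr' = tr[OF lt] tr[OF that(2)]
    show ?thesis
    proof (cases "card (common k m (ds ! t) (ds ! t')) \<le> card (common k m (ds' ! t) (ds' ! t'))")
      case True
      then show ?thesis
        using same_slice_iff[OF rig(1) tr' big(2) _ j that(3,4)] by simp
    next
      case False
      then show ?thesis
        using same_slice_iff[OF rig(2) tr'[symmetric] big(1) _ j] that(3,4)
          trace_eq_length[OF tr'(1) j] trace_eq_length[OF tr'(2) j] by simp
    qed
  qed
  consider "t < t'" | "t' < t" | "t = t'" by linarith
  then show ?thesis
  proof cases
    case 1
    then show ?thesis using * t a b by blast
  next
    case 2
    then show ?thesis using *[of t' t b a] t a b by (simp add: eq_commute)
  next
    case 3
    then show ?thesis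
      using a b trace_eq_length[OF tr[OF t(1)] j] by (simp add: kept_nth_eq_iff)
  qed
qed

lemma good_unique:
  assumes k: "k \<ge> 2" and good: "good s k m f ds" "good s k m f' ds'"
    and eq: "map (trace_of k m f) ds = map (trace_of k m f') ds'"
  shows "f = f'"
proof -
  have len: "length ds' = length ds"
    using eq by (metis length_map)
  have tr: "trace_of k m f (ds ! t) = trace_of k m f' (ds' ! t)" if "t < length ds" for t
    using eq len that by (metis nth_map)
  note lenk = trace_eq_length[OF tr]
  have cover: "\<exists>t<length ds. \<forall>w\<in>set ws. \<not> (ds ! t) w"
    if "set ws \<subseteq> {..<k} \<times> {..<m}" "length ws = k" for ws
    using good(1) that unfolding good_def covering_def slices_replicate by (metis in_set_conv_nth)
  have position: "\<exists>a<length (kept m (ds ! t) j). kept m (ds ! t) j ! a = i"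
    if "i < m" "\<not> (ds ! t) (j, i)" for t j i
    using that by (simp add: in_set_conv_nth[symmetric] set_kept)
  have pair: "\<exists>t<length ds. \<not> (ds ! t) (j, i) \<and> \<not> (ds ! t) (j, i')"
    if "j < k" "i < m" "i' < m" for j i i'
    \<comment> \<open>The second slice is repeated to reach length \<open>k\<close>.\<close>
    using cover[of "(j, i) # replicate (k - 1) (j, i')"] that k
    by (auto simp: set_replicate_conv_if)
  have "\<forall>j i. \<exists>t a. j < k \<longrightarrow> i < m \<longrightarrow> t < length ds \<and> a < length (kept m (ds ! t) j)
      \<and> kept m (ds ! t) j ! a = i"
    using pair position by metis
  then obtain \<tau> \<alpha> where \<tau>\<alpha>: "\<And>j i. j < k \<Longrightarrow> i < m \<Longrightarrow> \<tau> j i < length ds"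
    "\<And>j i. j < k \<Longrightarrow> i < m \<Longrightarrow> \<alpha> j i < length (kept m (ds ! \<tau> j i) j)"
    "\<And>j i. j < k \<Longrightarrow> i < m \<Longrightarrow> kept m (ds ! \<tau> j i) j ! \<alpha> j i = i"
    by metis
  \<comment> \<open>The index that the second explanation gives to slice \<open>i\<close> of the
    first, seen in a chosen trace. By \<open>good_same_slice_iff\<close> every other trace showing
    the slice gives the same index.\<close>
  define \<phi> where "\<phi> j i = kept m (ds' ! \<tau> j i) j ! \<alpha> j i" for j i
  have \<phi>: "\<phi> j (kept m (ds ! t) j ! a) = kept m (ds' ! t) j ! a"
    if "t < length ds" "j < k" "a < length (kept m (ds ! t) j)" for t j a
    unfolding \<phi>_def using that kept_nth(1)[OF that(3)] \<tau>\<alpha>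
    by (subst good_same_slice_iff[OF good eq, symmetric]) auto
  have \<phi>_id: "\<phi> j i = i" if j: "j < k" and "i < m" for i j
  proof (rule strict_mono_self_map_eq[where \<phi> = "\<phi> j"])
    \<comment> \<open>A trace showing both slices preserves their order in either
      explanation.\<close>
    fix i i' assume ii: "i < i'" "i' < m"
    then obtain t where t: "t < length ds" "\<not> (ds ! t) (j, i)" "\<not> (ds ! t) (j, i')"
      using pair[OF j, of i i'] by auto
    obtain a a' where a: "a < length (kept m (ds ! t) j)" "kept m (ds ! t) j ! a = i"
      "a' < length (kept m (ds ! t) j)" "kept m (ds ! t) j ! a' = i'"
      using position[of i t j] position[of i' t j] t ii by auto
    then have "a < a'"
      using kept_less_iff ii(1) by blast
    then have "kept m (ds' ! t) j ! a < kept m (ds' ! t) j ! a'"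
      using a lenk[OF t(1) j] by (simp add: kept_less_iff)
    then show "\<phi> j i < \<phi> j i'"
      using \<phi>[OF t(1) j] a by metis
  next
    fix i assume "i < m"
    then show "\<phi> j i < m"
      unfolding \<phi>_def using \<tau>\<alpha> j lenk by (intro kept_nth(1)) simp
  qed fact
  show ?thesis
  proof
    fix x
    show "f x = f' x"
    proof (cases "x \<in> tensor_idx (replicate k m)")
      case True
      then have x: "length x = k" "\<And>j. j < k \<Longrightarrow> x ! j < m"
        by (auto simp: tensor_idx_replicate)
      \<comment> \<open>The entry at \<open>x\<close> is visible in a trace that keeps the
        \<open>k\<close> slices through \<open>x\<close>.\<close>
      have "\<exists>t<length ds. \<forall>w\<in>set (map (\<lambda>j. (j, x ! j)) [0..<k]). \<not> (ds ! t) w"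
        using x by (intro cover) auto
      then obtain t where t: "t < length ds" "\<And>j. j < k \<Longrightarrow> \<not> (ds ! t) (j, x ! j)"
        by auto
      have "\<exists>a. j < k \<longrightarrow> a < length (kept m (ds ! t) j) \<and> kept m (ds ! t) j ! a = x ! j" for j
        using position[OF x(2) t(2), of j] by auto
      then obtain a where a: "\<And>j. j < k \<Longrightarrow> a j < length (kept m (ds ! t) j)"
        "\<And>j. j < k \<Longrightarrow> kept m (ds ! t) j ! a j = x ! j"
        by metis
      have a': "kept m (ds' ! t) j ! a j = x ! j" if "j < k" for j
      proof -
        have "kept m (ds' ! t) j ! a j = \<phi> j (kept m (ds ! t) j ! a j)"
          by (rule \<phi>[OF t(1) that a(1)[OF that], symmetric])
        also have "\<dots> = x ! j"
          unfolding a(2)[OF that] by (rule \<phi>_id[OF that x(2)[OF that]])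
        finally show ?thesis .
      qed
      have "f x = f (map (\<lambda>j. kept m (ds ! t) j ! a j) [0..<k])"
        using a(2) x(1) by (intro arg_cong[of _ _ f] nth_equalityI) auto
      also have "\<dots> = f' (map (\<lambda>j. kept m (ds' ! t) j ! a j) [0..<k])"
        by (rule trace_eq_entry[OF tr[OF t(1)] a(1)])
      also have "\<dots> = f' x"
        using a' x(1) by (intro arg_cong[of _ _ f'] nth_equalityI) auto
      finally show ?thesis .
    qed (use good in \<open>auto simp: good_def\<close>)
  qed
qed

subsection \<open>Random deletion patterns\<close>

lemma prob_bind_pmf:
  "measure_pmf.prob (bind_pmf A f) E = measure_pmf.expectation A (\<lambda>x. measure_pmf.prob (f x) E)"
proof -
  have "ennreal (measure_pmf.prob (bind_pmf A f) E)
          = (\<integral>\<^sup>+x. ennreal (measure_pmf.prob (f x) E) \<partial>measure_pmf A)"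
    by (simp add: measure_pmf.emeasure_eq_measure[symmetric])
  also have "\<dots> = ennreal (measure_pmf.expectation A (\<lambda>x. measure_pmf.prob (f x) E))"
    by (intro nn_integral_eq_integral measure_pmf.integrable_const_bound[where B = 1]) auto
  finally show ?thesis
    by (simp add: integral_nonneg_AE)
qed

lemma prob_bind_pmf_le:
  assumes "\<And>x. x \<in> set_pmf A \<Longrightarrow> measure_pmf.prob (f x) E \<le> c"
  shows "measure_pmf.prob (bind_pmf A f) E \<le> c"
  unfolding prob_bind_pmf
  by (rule measure_pmf.integral_le_const)
     (use assms in \<open>auto intro!: measure_pmf.integrable_const_bound[where B = 1] simp: AE_measure_pmf_iff\<close>)

lemma replicate_pmf_Suc_map:
  "replicate_pmf (Suc n) p = bind_pmf p (\<lambda>x. map_pmf ((#) x) (replicate_pmf n p))"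
  by (simp add: map_pmf_def)

lemma replicate_pmf_map: "replicate_pmf n (map_pmf g p) = map_pmf (map g) (replicate_pmf n p)"
  by (induction n) (simp_all add: map_pmf_def bind_assoc_pmf bind_return_pmf)

lemma prob_replicate_all:
  "measure_pmf.prob (replicate_pmf n p) {xs. \<forall>x\<in>set xs. Q x} = measure_pmf.prob p {x. Q x} ^ n"
proof (induction n)
  case 0
  then show ?case by (simp add: measure_return_pmf)
next
  case (Suc n)
  have "measure_pmf.prob (map_pmf ((#) x) (replicate_pmf n p)) {xs. \<forall>x\<in>set xs. Q x}
          = indicator {x. Q x} x * measure_pmf.prob p {x. Q x} ^ n" for x
    using Suc.IH by (simp add: vimage_def indicator_def)
  then show ?case
    by (simp add: replicate_pmf_Suc_map prob_bind_pmf del: replicate_pmf.simps)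
qed

lemma prob_not: "measure_pmf.prob p {x. \<not> Q x} = 1 - measure_pmf.prob p {x. Q x}"
  using measure_pmf.prob_compl[of "{x. Q x}" p] by (simp add: set_diff_eq)

lemma prob_replicate_ex_le:
  "measure_pmf.prob (replicate_pmf n p) {xs. \<exists>x\<in>set xs. Q x} \<le> n * measure_pmf.prob p {x. Q x}"
proof -
  have "measure_pmf.prob (replicate_pmf n p) {xs. \<exists>x\<in>set xs. Q x}
      = 1 - measure_pmf.prob (replicate_pmf n p) {xs. \<forall>x\<in>set xs. \<not> Q x}"
    using prob_not[of "replicate_pmf n p" "\<lambda>xs. \<forall>x\<in>set xs. \<not> Q x"] by simp
  also have "\<dots> = 1 - (1 - measure_pmf.prob p {x. Q x}) ^ n"
    by (simp add: prob_replicate_all prob_not)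
  also have "\<dots> \<le> n * measure_pmf.prob p {x. Q x}"
    using Bernoulli_inequality[of "- measure_pmf.prob p {x. Q x}" n] by simp
  finally show ?thesis .
qed

text \<open>Union bound over pairs of samples, with the failure of \<open>R\<close> averaged over
  both. A new head is compared with \<open>n\<close> samples, and n + n^2 \<le> (n + 1)^2.\<close>

lemma prob_replicate_not_sorted_wrt_le:
  assumes e: "measure_pmf.expectation p (\<lambda>x. measure_pmf.prob p {y. \<not> R x y}) \<le> e"
  shows "measure_pmf.prob (replicate_pmf n p) {xs. \<not> sorted_wrt R xs} \<le> (real n)\<^sup>2 * e"
proof (induction n)
  case 0
  then show ?case by (simp add: measure_return_pmf)
next
  case (Suc n)
  let ?r = "replicate_pmf n p"
  have e0: "0 \<le> e"
    using e by (rule order_trans[rotated]) (simp add: integral_nonneg_AE)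
  have int: "integrable (measure_pmf p) (\<lambda>x. measure_pmf.prob p {y. \<not> R x y})"
    by (auto intro!: measure_pmf.integrable_const_bound[where B = 1])
  have "measure_pmf.prob (map_pmf ((#) x) ?r) {xs. \<not> sorted_wrt R xs}
          \<le> n * measure_pmf.prob p {y. \<not> R x y} + (real n)\<^sup>2 * e" for x
  proof -
    have "measure_pmf.prob (map_pmf ((#) x) ?r) {xs. \<not> sorted_wrt R xs}
        = measure_pmf.prob ?r ({xs. \<exists>y\<in>set xs. \<not> R x y} \<union> {xs. \<not> sorted_wrt R xs})"
      by (auto intro!: arg_cong[of _ _ "measure_pmf.prob _"])
    also have "\<dots> \<le> measure_pmf.prob ?r {xs. \<exists>y\<in>set xs. \<not> R x y}
        + measure_pmf.prob ?r {xs. \<not> sorted_wrt R xs}"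
      by (rule measure_Un_le) auto
    also have "\<dots> \<le> n * measure_pmf.prob p {y. \<not> R x y} + (real n)\<^sup>2 * e"
      using prob_replicate_ex_le Suc.IH by (rule add_mono)
    finally show ?thesis .
  qed
  then have "measure_pmf.prob (replicate_pmf (Suc n) p) {xs. \<not> sorted_wrt R xs}
      \<le> measure_pmf.expectation p (\<lambda>x. n * measure_pmf.prob p {y. \<not> R x y} + (real n)\<^sup>2 * e)"
    unfolding replicate_pmf_Suc_map prob_bind_pmf
    by (intro integral_mono Bochner_Integration.integrable_add integrable_mult_right int)
       (auto intro!: measure_pmf.integrable_const_bound[where B = 1])
  also have "\<dots> = n * measure_pmf.expectation p (\<lambda>x. measure_pmf.prob p {y. \<not> R x y})
      + (real n)\<^sup>2 * e"
    using int by simp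
  also have "\<dots> \<le> n * e + (real n)\<^sup>2 * e"
    using e by (intro add_mono mult_left_mono) auto
  also have "\<dots> \<le> (real (Suc n))\<^sup>2 * e"
    using e0 by (simp add: power2_eq_square algebra_simps)
  finally show ?case .
qed

section \<open>Failure probabilities of coverage, overlap and rigidity\<close>

definition deletion_pattern :: "real \<Rightarrow> nat \<Rightarrow> nat \<Rightarrow> (nat \<times> nat \<Rightarrow> bool) pmf" where
  "deletion_pattern p k m = Pi_pmf ({..<k} \<times> {..<m}) False (\<lambda>_. bernoulli_pmf p)"

lemma finite_set_deletion_pattern: "finite (set_pmf (deletion_pattern p k m))"
  unfolding deletion_pattern_def
  by (rule finite_subset[OF set_Pi_pmf_subset']) (auto intro: finite_PiE_dflt)

lemma prob_all_kept:
  assumes "0 \<le> p" "p \<le> 1" "W \<subseteq> {..<k} \<times> {..<m}"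
  shows "measure_pmf.prob (deletion_pattern p k m) {d. \<forall>w\<in>W. \<not> d w} = (1 - p) ^ card W"
proof -
  let ?I = "{..<k} \<times> {..<m}"
  have "{d. \<forall>w\<in>W. \<not> d w} = Pi ?I (\<lambda>w. if w \<in> W then {False} else UNIV)"
    using assms(3) by (auto simp: Pi_def)
  then have "measure_pmf.prob (deletion_pattern p k m) {d. \<forall>w\<in>W. \<not> d w}
      = (\<Prod>w\<in>?I. if w \<in> W then 1 - p else 1)"
    using assms(1,2)
    by (auto simp: deletion_pattern_def measure_Pi_pmf_Pi measure_pmf_single intro!: prod.cong)
  also have "\<dots> = (1 - p) ^ card W"
    using assms(3) by (simp add: prod.If_cases Int_absorb1)
  finally show ?thesis .
qed

text \<open>Union bound over (k m)^k lists. One pattern keeps the at most \<open>k\<close> distinct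
  slices of a list with probability at least (1 - p)^k, and the \<open>T\<close> patterns are
  independent.\<close>

lemma prob_not_covering_le:
  assumes "0 \<le> p" "p \<le> 1"
  shows "measure_pmf.prob (replicate_pmf T (deletion_pattern p k m)) {ds. \<not> covering k m ds}
           \<le> (real k * m) ^ k * (1 - (1 - p) ^ k) ^ T"
proof -
  let ?P = "measure_pmf.prob (replicate_pmf T (deletion_pattern p k m))"
  define L where "L = {ws. set ws \<subseteq> {..<k} \<times> {..<m} \<and> length ws = k}"
  have L: "finite L" "card L = (k * m) ^ k"
    unfolding L_def by (simp_all add: finite_lists_length_eq card_lists_length_eq card_cartesian_product)
  have "?P {ds. \<not> covering k m ds} \<le> ?P (\<Union>ws\<in>L. {ds. \<forall>d\<in>set ds. \<exists>w\<in>set ws. d w})"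
    by (rule measure_pmf.finite_measure_mono) (auto simp: covering_def slices_replicate L_def)
  also have "\<dots> \<le> (\<Sum>ws\<in>L. ?P {ds. \<forall>d\<in>set ds. \<exists>w\<in>set ws. d w})"
    by (rule measure_pmf.finite_measure_subadditive_finite[OF L(1)]) simp
  also have "\<dots> \<le> (\<Sum>ws\<in>L. (1 - (1 - p) ^ k) ^ T)"
  proof (rule sum_mono)
    fix ws assume "ws \<in> L"
    then have ws: "set ws \<subseteq> {..<k} \<times> {..<m}" "card (set ws) \<le> k"
      using card_length[of ws] by (auto simp: L_def)
    have "measure_pmf.prob (deletion_pattern p k m) {d. \<exists>w\<in>set ws. d w}
        = 1 - measure_pmf.prob (deletion_pattern p k m) {d. \<forall>w\<in>set ws. \<not> d w}"
      using prob_not[of "deletion_pattern p k m" "\<lambda>d. \<forall>w\<in>set ws. \<not> d w"] by simp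
    also have "\<dots> \<le> 1 - (1 - p) ^ k"
      using assms ws power_decreasing[OF ws(2), of "1 - p"] by (simp add: prob_all_kept)
    finally show "?P {ds. \<forall>d\<in>set ds. \<exists>w\<in>set ws. d w} \<le> (1 - (1 - p) ^ k) ^ T"
      unfolding prob_replicate_all by (intro power_mono) auto
  qed
  also have "\<dots> = (real k * m) ^ k * (1 - (1 - p) ^ k) ^ T"
    by (simp add: L(2))
  finally show ?thesis .
qed

lemma card_common_slice:
  assumes "j < k"
  shows "card (common k m d d' `` {j}) = card {w \<in> {..<k} \<times> {..<m}. fst w = j \<and> \<not> d w \<and> \<not> d' w}"
proof (rule bij_betw_same_card)
  show "bij_betw (\<lambda>(x, y). (j, x)) (common k m d d' `` {j})
          {w \<in> {..<k} \<times> {..<m}. fst w = j \<and> \<not> d w \<and> \<not> d' w}"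
    by (rule bij_betw_byWitness[where f' = "\<lambda>(j, x). (x, x)"])
       (use assms in \<open>auto simp: common_def\<close>)
qed

text \<open>Exponential moment bound with base 1/2 for the overlap c along one dimension. An index
  survives in both traces with probability (1 - p)^2, so it contributes the factor 1 - (1 - p)^2 / 2
  to the mean of (1/2)^c.\<close>

lemma prob_not_overlapping_le:
  assumes p: "0 \<le> p" "p \<le> 1"
  shows "measure_pmf.prob (replicate_pmf T (deletion_pattern p k m)) {ds. \<not> overlapping s k m ds}
           \<le> (real T)\<^sup>2 * (k * (2 powr s * (1 - (1 - p)\<^sup>2 / 2) ^ m))"
  unfolding overlapping_def
proof (rule prob_replicate_not_sorted_wrt_le)
  let ?D = "deletion_pattern p k m"
  let ?I = "{..<k} \<times> {..<m}"
  let ?E = "measure_pmf.expectation ?D"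
  note [simp] = integrable_measure_pmf_finite[OF finite_set_deletion_pattern]
  define c where "c j d d' = card (common k m d d' `` {j})" for j d d'
  \<comment> \<open>With \<open>d\<close> fixed, an index kept by \<open>d\<close> contributes p +
    (1 - p) / 2; averaging over \<open>d\<close> follows in \<open>EEc\<close>.\<close>
  have Ec: "?E (\<lambda>d'. (1/2) ^ c j d d') = (\<Prod>w\<in>?I. if fst w = j \<and> \<not> d w then (1 + p) / 2 else 1)"
    if "j < k" for j d
  proof -
    have "(1/2 :: real) ^ c j d d' = (\<Prod>w\<in>?I. if fst w = j \<and> \<not> d w \<and> \<not> d' w then 1/2 else 1)" for d'
      by (simp add: c_def card_common_slice[OF that] prod.If_cases Int_def)
    then have "?E (\<lambda>d'. (1/2 :: real) ^ c j d d')
        = ?E (\<lambda>d'. \<Prod>w\<in>?I. if fst w = j \<and> \<not> d w \<and> \<not> d' w then 1/2 else 1)"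
      by simp
    also have "\<dots> = (\<Prod>w\<in>?I. measure_pmf.expectation (bernoulli_pmf p)
        (\<lambda>b. if fst w = j \<and> \<not> d w \<and> \<not> b then 1/2 else 1))"
      unfolding deletion_pattern_def
      by (subst expectation_prod_Pi_pmf) (auto intro: integrable_measure_pmf_finite)
    also have "\<dots> = (\<Prod>w\<in>?I. if fst w = j \<and> \<not> d w then (1 + p) / 2 else 1)"
      using p by (intro prod.cong) (auto simp: field_simps)
    finally show ?thesis .
  qed
  have EEc: "?E (\<lambda>d. ?E (\<lambda>d'. (1/2) ^ c j d d')) = (1 - (1 - p)\<^sup>2 / 2) ^ m" if "j < k" for j
  proof -
    have "?E (\<lambda>d. ?E (\<lambda>d'. (1/2) ^ c j d d'))
        = (\<Prod>w\<in>?I. measure_pmf.expectation (bernoulli_pmf p)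
            (\<lambda>b. if fst w = j \<and> \<not> b then (1 + p) / 2 else 1))"
      unfolding Ec[OF that] unfolding deletion_pattern_def
      using p by (subst expectation_prod_Pi_pmf) (auto intro: integrable_measure_pmf_finite)
    also have "\<dots> = (\<Prod>w\<in>?I. if fst w = j then 1 - (1 - p)\<^sup>2 / 2 else 1)"
      using p by (intro prod.cong) (auto simp: field_simps power2_eq_square)
    also have "\<dots> = (1 - (1 - p)\<^sup>2 / 2) ^ card {w \<in> ?I. fst w = j}"
      by (simp add: prod.If_cases Int_def)
    also have "{w \<in> ?I. fst w = j} = {j} \<times> {..<m}"
      using that by auto
    finally show ?thesis by (simp add: card_cartesian_product)
  qed
  have "measure_pmf.prob ?D {d'. \<not> (\<forall>j<k. s \<le> c j d d')}
      \<le> (\<Sum>j<k. 2 powr s * ?E (\<lambda>d'. (1/2) ^ c j d d'))" for d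
  proof -
    have "measure_pmf.prob ?D {d'. \<not> (\<forall>j<k. s \<le> c j d d')}
        = measure_pmf.prob ?D (\<Union>j<k. {d'. c j d d' < s})"
      by (intro arg_cong[of _ _ "measure_pmf.prob _"]) auto
    also have "\<dots> \<le> (\<Sum>j<k. measure_pmf.prob ?D {d'. c j d d' < s})"
      by (rule measure_pmf.finite_measure_subadditive_finite) auto
    also have "\<dots> \<le> (\<Sum>j<k. 2 powr s * ?E (\<lambda>d'. (1/2) ^ c j d d'))"
    proof (rule sum_mono)
      fix j
      have "measure_pmf.prob ?D {d'. c j d d' < s} = ?E (indicator {d'. c j d d' < s})"
        by simp
      \<comment> \<open>Markov's inequality: 2^(s - c) is at least 1 where c < s.\<close>
      also have "\<dots> \<le> ?E (\<lambda>d'. 2 powr s * (1/2) ^ c j d d')"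
      proof (rule integral_mono)
        fix d'
        have "(1/2) ^ c j d d' = 2 powr (- real (c j d d'))"
          by (simp add: powr_minus powr_realpow power_one_over inverse_eq_divide)
        then have "2 powr s * (1/2) ^ c j d d' = 2 powr (s - c j d d')"
          by (simp add: powr_add[symmetric])
        then show "indicator {d'. c j d d' < s} d' \<le> 2 powr s * (1/2) ^ c j d d'"
          by (auto simp: indicator_def ge_one_powr_ge_zero)
      qed auto
      finally show "measure_pmf.prob ?D {d'. c j d d' < s} \<le> 2 powr s * ?E (\<lambda>d'. (1/2) ^ c j d d')"
        by simp
    qed
    finally show ?thesis .
  qed
  then have "?E (\<lambda>d. measure_pmf.prob ?D {d'. \<not> (\<forall>j<k. s \<le> c j d d')})
      \<le> ?E (\<lambda>d. \<Sum>j<k. 2 powr s * ?E (\<lambda>d'. (1/2) ^ c j d d'))"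
    by (intro integral_mono) auto
  also have "\<dots> = k * (2 powr s * (1 - (1 - p)\<^sup>2 / 2) ^ m)"
    using EEc by simp
  finally show "?E (\<lambda>d. measure_pmf.prob ?D {d'. \<not> (\<forall>j<k. s \<le> card (common k m d d' `` {j}))})
      \<le> k * (2 powr s * (1 - (1 - p)\<^sup>2 / 2) ^ m)"
    by (simp add: c_def)
qed

lemma prob_not_all_rigid_le:
  assumes "k \<ge> 2" "s \<ge> 1"
  shows "measure_pmf.prob (Pi_pmf (tensor_idx (replicate k m)) False (\<lambda>_. bernoulli_pmf (1/2)))
           {f. \<not> all_rigid s k m f ds}
           \<le> (real (length ds))\<^sup>2 * ((1 + 2 powr (- s / (4 * k))) ^ (k * m\<^sup>2) - 1)"
proof -
  let ?P = "measure_pmf.prob (Pi_pmf (tensor_idx (replicate k m)) False (\<lambda>_. bernoulli_pmf (1/2)))"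
  let ?J = "{..<length ds} \<times> {..<length ds}"
  have "?P {f. \<not> all_rigid s k m f ds}
      \<le> ?P (\<Union>t\<in>?J. {f. \<not> rigid s k m (common k m (ds ! fst t) (ds ! snd t)) f})"
    by (rule measure_pmf.finite_measure_mono)
       (force simp: all_rigid_def sorted_wrt_iff_nth_less)+
  also have "\<dots> \<le> (\<Sum>t\<in>?J. ?P {f. \<not> rigid s k m (common k m (ds ! fst t) (ds ! snd t)) f})"
    by (rule measure_pmf.finite_measure_subadditive_finite) auto
  also have "\<dots> \<le> (\<Sum>t\<in>?J. (1 + 2 powr (- s / (4 * k))) ^ (k * m\<^sup>2) - 1)"
    using assms by (intro sum_mono prob_not_rigid_le) (auto simp: common_def)
  finally show ?thesis
    by (simp add: card_cartesian_product power2_eq_square)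
qed

subsection \<open>Decoding\<close>

definition decode :: "real \<Rightarrow> nat \<Rightarrow> nat \<Rightarrow> tensor list \<Rightarrow> tensor" where
  "decode s k m ys = Tensor (replicate k m) (SOME f. \<exists>ds. good s k m f ds \<and> map (trace_of k m f) ds = ys)"

lemma decode_good:
  assumes "k \<ge> 2" "good s k m f ds"
  shows "decode s k m (map (trace_of k m f) ds) = Tensor (replicate k m) f"
proof -
  have "(SOME f'. \<exists>ds'. good s k m f' ds' \<and> map (trace_of k m f') ds' = map (trace_of k m f) ds) = f"
    by (rule some_equality) (use assms good_unique in \<open>blast+\<close>)
  then show ?thesis by (simp add: decode_def)
qed

lemma deletion_channel_eq:
  "deletion_channel p (Tensor (replicate k m) f) = map_pmf (trace_of k m f) (deletion_pattern p k m)"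
  by (simp add: deletion_channel_def deletion_pattern_def trace_of_def[abs_def] slices_replicate)

text \<open>Deletion patterns are drawn without regard to the entries, so tensor and patterns form
  an independent pair. Rigidity can then be bounded with the patterns held fixed.\<close>

lemma tensor_with_traces_eq:
  "tensor_with_traces p T (replicate k m) =
     map_pmf (\<lambda>(f, ds). (Tensor (replicate k m) f, map (trace_of k m f) ds))
       (pair_pmf (Pi_pmf (tensor_idx (replicate k m)) False (\<lambda>_. bernoulli_pmf (1/2)))
          (replicate_pmf T (deletion_pattern p k m)))"
  unfolding tensor_with_traces_def uniform_tensor_def pair_pmf_def
  by (simp add: bind_map_pmf deletion_channel_eq replicate_pmf_map map_bind_pmf
      map_pmf_def[symmetric] pmf.map_comp o_def)

lemma prob_pair_snd:
  "measure_pmf.prob (pair_pmf A B) {(f, ds). Q ds} = measure_pmf.prob B {ds. Q ds}"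
proof -
  have "measure_pmf.prob B {ds. Q ds} = measure_pmf.prob (map_pmf snd (pair_pmf A B)) {ds. Q ds}"
    by (simp add: map_snd_pair_pmf)
  also have "\<dots> = measure_pmf.prob (pair_pmf A B) {(f, ds). Q ds}"
    by (auto intro!: arg_cong[of _ _ "measure_pmf.prob _"])
  finally show ?thesis ..
qed

lemma prob_pair_le:
  assumes "\<And>ds. ds \<in> set_pmf B \<Longrightarrow> measure_pmf.prob A {f. Q f ds} \<le> c"
  shows "measure_pmf.prob (pair_pmf A B) {(f, ds). Q f ds} \<le> c"
proof -
  have "pair_pmf A B = bind_pmf B (\<lambda>ds. map_pmf (\<lambda>f. (f, ds)) A)"
    unfolding pair_pmf_def map_pmf_def by (rule bind_commute_pmf)
  then show ?thesis
    using assms by (auto intro!: prob_bind_pmf_le simp: vimage_def)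
qed

lemma prob_decode_ge:
  fixes T k m :: nat
  assumes k: "k \<ge> 2" and s: "s \<ge> 1" and p: "0 \<le> p" "p \<le> 1"
  shows "measure_pmf.prob (tensor_with_traces p T (replicate k m)) {(X, ys). decode s k m ys = X}
    \<ge> 1 - ((real k * m) ^ k * (1 - (1 - p) ^ k) ^ T
         + (real T)\<^sup>2 * (k * (2 powr s * (1 - (1 - p)\<^sup>2 / 2) ^ m))
         + (real T)\<^sup>2 * ((1 + 2 powr (- s / (4 * k))) ^ (k * m\<^sup>2) - 1))"
proof -
  let ?A = "Pi_pmf (tensor_idx (replicate k m)) False (\<lambda>_. bernoulli_pmf (1/2))"
  let ?B = "replicate_pmf T (deletion_pattern p k m)"
  let ?P = "measure_pmf.prob (pair_pmf ?A ?B)"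
  let ?bad1 = "{(f :: nat list \<Rightarrow> bool, ds). \<not> covering k m ds}"
  let ?bad2 = "{(f :: nat list \<Rightarrow> bool, ds). \<not> overlapping s k m ds}"
  let ?bad3 = "{(f, ds). \<not> all_rigid s k m f ds}"
  have outside: "\<not> f x" if "f \<in> set_pmf ?A" "x \<notin> tensor_idx (replicate k m)" for f x
    using subsetD[OF set_Pi_pmf_subset[OF finite_tensor_idx] that(1)] that(2) by simp
  \<comment> \<open>Restricting to the support discharges the last clause of \<open>good\<close>:
    the default value \<open>False\<close> holds outside the index range.\<close>
  have "?P {(f, ds). \<not> good s k m f ds} = ?P ({(f, ds). \<not> good s k m f ds} \<inter> set_pmf (pair_pmf ?A ?B))"
    by (rule measure_Int_set_pmf[symmetric])
  also have "\<dots> \<le> ?P (?bad1 \<union> ?bad2 \<union> ?bad3)"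
    by (rule measure_pmf.finite_measure_mono) (use outside in \<open>auto simp: good_def\<close>)
  also have "\<dots> \<le> ?P (?bad1 \<union> ?bad2) + ?P ?bad3"
    by (rule measure_Un_le) auto
  also have "?P (?bad1 \<union> ?bad2) \<le> ?P ?bad1 + ?P ?bad2"
    by (rule measure_Un_le) auto
  also have "?P ?bad1 \<le> (real k * m) ^ k * (1 - (1 - p) ^ k) ^ T"
    unfolding prob_pair_snd by (rule prob_not_covering_le[OF p])
  also have "?P ?bad2 \<le> (real T)\<^sup>2 * (k * (2 powr s * (1 - (1 - p)\<^sup>2 / 2) ^ m))"
    unfolding prob_pair_snd by (rule prob_not_overlapping_le[OF p])
  also have "?P ?bad3 \<le> (real T)\<^sup>2 * ((1 + 2 powr (- s / (4 * k))) ^ (k * m\<^sup>2) - 1)"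
  proof (rule prob_pair_le)
    fix ds assume "ds \<in> set_pmf ?B"
    then have "length ds = T"
      by (auto simp: set_replicate_pmf)
    then show "measure_pmf.prob ?A {f. \<not> all_rigid s k m f ds}
        \<le> (real T)\<^sup>2 * ((1 + 2 powr (- s / (4 * k))) ^ (k * m\<^sup>2) - 1)"
      using prob_not_all_rigid_le[OF k s, of m ds] by simp
  qed
  finally have bad: "?P {(f, ds). \<not> good s k m f ds}
      \<le> (real k * m) ^ k * (1 - (1 - p) ^ k) ^ T
         + (real T)\<^sup>2 * (k * (2 powr s * (1 - (1 - p)\<^sup>2 / 2) ^ m))
         + (real T)\<^sup>2 * ((1 + 2 powr (- s / (4 * k))) ^ (k * m\<^sup>2) - 1)"
    by simp
  have "1 - ?P {(f, ds). \<not> good s k m f ds} = ?P {(f, ds). good s k m f ds}"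
  proof -
    have "{(f, ds). \<not> good s k m f ds} = {x. \<not> (case x of (f, ds) \<Rightarrow> good s k m f ds)}"
      by auto
    then show ?thesis
      using prob_not[of "pair_pmf ?A ?B" "\<lambda>(f, ds). good s k m f ds"] by simp
  qed
  also have "\<dots> \<le> measure_pmf.prob (tensor_with_traces p T (replicate k m)) {(X, ys). decode s k m ys = X}"
    unfolding tensor_with_traces_eq
    by (subst measure_map_pmf, rule measure_pmf.finite_measure_mono) (auto simp: decode_good[OF k])
  finally show ?thesis
    using bad by simp
qed

section \<open>Asymptotics with logarithmically many traces\<close>

text \<open>The choice s = sqrt m is small enough for r^m to beat 2^s and large enough for 2^(-s /
  (4 k)) to beat m^2 and the squared logarithm.\<close>

lemma failure_tendsto_0:
  fixes a r k :: real
  assumes "a > 0" "k > 0" "0 < r" "r < 1" "n > 0"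
  shows "(\<lambda>m. (k / real m) ^ n + (a * ln (real m) + 1)\<^sup>2 * (k * (2 powr sqrt (real m) * r ^ m))
    + (a * ln (real m) + 1)\<^sup>2 * (exp (k * (real m)\<^sup>2 * 2 powr (- sqrt (real m) / (4 * k))) - 1)) \<longlonglongrightarrow> 0"
proof -
  have "(\<lambda>m. (k / real m) ^ n) \<longlonglongrightarrow> 0 ^ n"
    by (intro tendsto_power) real_asymp
  then have 1: "(\<lambda>m. (k / real m) ^ n) \<longlonglongrightarrow> 0"
    using assms by (simp add: power_0_left)
  have 2: "(\<lambda>m. (a * ln (real m) + 1)\<^sup>2 * (k * (2 powr sqrt (real m) * r ^ m))) \<longlonglongrightarrow> 0"
    using assms by real_asymp
  have 3: "(\<lambda>m. (a * ln (real m) + 1)\<^sup>2 *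
      (exp (k * (real m)\<^sup>2 * 2 powr (- sqrt (real m) / (4 * k))) - 1)) \<longlonglongrightarrow> 0"
    using assms by real_asymp
  show ?thesis
    using tendsto_add[OF tendsto_add[OF 1 2] 3] by simp
qed

theorem theorem15:
  "\<exists>C::real. C > 0 \<and>
     (\<forall>k::nat. \<forall>p::real. k \<ge> 2 \<longrightarrow> 0 \<le> p \<longrightarrow> p < 1 \<longrightarrow>
       (\<exists>R :: nat \<Rightarrow> tensor list \<Rightarrow> tensor.
         (\<lambda>m. measure_pmf.prob
                (tensor_with_traces p (nat \<lceil>C * ln (real (m ^ k)) / (1 - p) ^ k\<rceil>) (replicate k m))
                {(X, ys). R m ys = X}) \<longlonglongrightarrow> 1))"
\<comment> \<open>With constant 2 the coverage factor (1 - z)^T is at most m^(-2 k); against the (k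
  m)^k lists this leaves (k / m)^k.\<close>
proof (intro exI[of _ 2] conjI allI impI)
  fix k :: nat and p :: real
  assume k: "k \<ge> 2" and p: "0 \<le> p" "p < 1"
  define z where "z = (1 - p) ^ k"
  define r where "r = 1 - (1 - p)\<^sup>2 / 2"
  define T where "T m = nat \<lceil>2 * ln (real (m ^ k)) / z\<rceil>" for m
  \<comment> \<open>Chosen so that \<open>T m\<close> is at most a ln m + 1, the 1 coming from the
    ceiling.\<close>
  define a where "a = 2 * k / z"
  define fail where "fail m = (k / real m) ^ k
    + (a * ln (real m) + 1)\<^sup>2 * (k * (2 powr sqrt (real m) * r ^ m))
    + (a * ln (real m) + 1)\<^sup>2 * (exp (k * (real m)\<^sup>2 * 2 powr (- sqrt (real m) / (4 * real k))) - 1)" for m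
  have z: "0 < z" "z \<le> 1"
    using p by (auto simp: z_def power_le_one)
  have sq: "0 < (1 - p)\<^sup>2" "(1 - p)\<^sup>2 \<le> 1"
    using p by (auto simp: power_le_one)
  then have r: "0 < r" "r < 1"
    by (auto simp: r_def)
  let ?prob = "\<lambda>m. measure_pmf.prob (tensor_with_traces p (T m) (replicate k m))
    {(X, ys). decode (sqrt (real m)) k m ys = X}"
  have lower: "1 - fail m \<le> ?prob m" if m: "m \<ge> 1" for m
  proof -
    have ln: "ln (real (m ^ k)) = k * ln (real m)" "0 \<le> ln (real m)"
      using m by (simp_all add: ln_realpow)
    have T_ge: "2 * k * ln (real m) \<le> z * T m"
    proof -
      have "2 * ln (real (m ^ k)) / z \<le> T m"
        unfolding T_def by linarith
      then show ?thesis
        using z unfolding ln(1) by (simp add: field_simps)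
    qed
    have "0 \<le> 2 * ln (real (m ^ k)) / z"
      using ln z by (simp del: of_nat_power)
    then have "real (T m) \<le> 2 * ln (real (m ^ k)) / z + 1"
      unfolding T_def by linarith
    then have T_le: "(real (T m))\<^sup>2 \<le> (a * ln (real m) + 1)\<^sup>2"
      unfolding ln(1) by (intro power_mono) (simp_all add: a_def)
    have "(1 - z) ^ T m \<le> exp (- z) ^ T m"
      using z exp_ge_add_one_self[of "- z"] by (intro power_mono) auto
    also have "\<dots> = exp (- (z * T m))"
      by (simp add: exp_of_nat_mult[symmetric] mult.commute)
    also have "\<dots> \<le> exp (- (2 * k * ln (real m)))"
      using T_ge by simp
    also have "\<dots> = (1 / real m) ^ (2 * k)"
    proof -
      have "exp (- (2 * k * ln (real m))) = inverse (exp (real (2 * k) * ln (real m)))"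
        by (simp add: exp_minus)
      also have "exp (real (2 * k) * ln (real m)) = real m ^ (2 * k)"
        using m by (subst exp_of_nat_mult) simp
      finally show ?thesis by (simp add: power_one_over inverse_eq_divide)
    qed
    finally have "(real k * m) ^ k * (1 - z) ^ T m \<le> (real k * m) ^ k * (1 / real m) ^ (2 * k)"
      by (intro mult_left_mono) auto
    also have "\<dots> = (real k * m * (1 / real m)\<^sup>2) ^ k"
      by (simp add: power_mult_distrib power_mult)
    also have "real k * m * (1 / real m)\<^sup>2 = k / real m"
      using m by (simp add: power2_eq_square)
    finally have 1: "(real k * m) ^ k * (1 - z) ^ T m \<le> (k / real m) ^ k" .
    have 2: "(real (T m))\<^sup>2 * (k * (2 powr sqrt (real m) * r ^ m))
        \<le> (a * ln (real m) + 1)\<^sup>2 * (k * (2 powr sqrt (real m) * r ^ m))"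
      using T_le r by (intro mult_right_mono) auto
    define u where "u = 2 powr (- sqrt (real m) / (4 * k))"
    \<comment> \<open>The exponential form is the one treated in
      \<open>failure_tendsto_0\<close>.\<close>
    have "(1 + u) ^ (k * m\<^sup>2) \<le> exp u ^ (k * m\<^sup>2)"
      by (intro power_mono exp_ge_add_one_self) (simp add: u_def)
    also have "\<dots> = exp (k * (real m)\<^sup>2 * u)"
      by (simp add: exp_of_nat_mult[symmetric])
    finally have "(1 + u) ^ (k * m\<^sup>2) \<le> exp (k * (real m)\<^sup>2 * u)" .
    moreover have "1 \<le> (1 + u) ^ (k * m\<^sup>2)"
      by (intro one_le_power) (simp add: u_def)
    ultimately have 3: "(real (T m))\<^sup>2 * ((1 + u) ^ (k * m\<^sup>2) - 1)
        \<le> (a * ln (real m) + 1)\<^sup>2 * (exp (k * (real m)\<^sup>2 * u) - 1)"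
      using T_le by (intro mult_mono) auto
    have "sqrt (real m) \<ge> 1"
      using m by simp
    from prob_decode_ge[OF k this p(1), where T = "T m" and m = m] p(2) 1 2 3 show ?thesis
      unfolding fail_def z_def[symmetric] r_def[symmetric] u_def by simp
  qed
  have "fail \<longlonglongrightarrow> 0"
    unfolding fail_def using k z r by (intro failure_tendsto_0) (auto simp: a_def)
  then have "(\<lambda>m. 1 - fail m) \<longlonglongrightarrow> 1 - 0"
    by (intro tendsto_diff tendsto_const)
  then have "?prob \<longlonglongrightarrow> 1"
    by (intro tendsto_sandwich[of "\<lambda>m. 1 - fail m" ?prob sequentially "\<lambda>_. 1"])
       (auto intro!: eventually_sequentiallyI[of 1] lower)
  then show "\<exists>R :: nat \<Rightarrow> tensor list \<Rightarrow> tensor.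
         (\<lambda>m. measure_pmf.prob
                (tensor_with_traces p (nat \<lceil>2 * ln (real (m ^ k)) / (1 - p) ^ k\<rceil>) (replicate k m))
                {(X, ys). R m ys = X}) \<longlonglongrightarrow> 1"
    unfolding T_def z_def by (intro exI[of _ "\<lambda>m. decode (sqrt (real m)) k m"])
qed simp

end
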